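(* Let $\mathbb{X}$ be a finite-dimensional real polyhedral Banach space and $1\le k\le\dim\mathbb{X}$. If a linear operator $T:\mathbb{X}\to\mathbb{X}$ preserves Birkhoff–James orthogonality at each $k$-smooth point of $S_{\mathbb{X}}$, then $T$ is a scalar multiple of an isometry (there is $\lambda\ge0$ with $\|Tx\|=\lambda\|x\|$ for all $x$); i.e. the set of $k$-smooth points of the unit sphere is a $\mathcal{K}$-set.
   Context: A finite-dimensional Banach space is polyhedral if its closed unit ball has finitely many extreme points. For non-zero $z$, $J(z)=\{f\in\mathbb{X}^*:\|f\|=1,\ f(z)=\|z\|\}$; $z$ is $k$-smooth if $\dim\operatorname{span}J(z)=k$. $u\perp_B v$ means $\|u+\lambda v\|\ge\|u\|$ for all real $\lambda$; $T$ preserves Birkhoff–James orthogonality at $x$ if $x\perp_B w\Rightarrow Tx\perp_B Tw$ for all $w$. A set $A\subseteq S_{\mathbb{X}}$ is a $\mathcal{K}$-set if every linear $T:\mathbb{X}\to\mathbb{X}$ preserving Birkhoff–James orthogonality at each point of $A$ is a scalar multiple of an isometry. *)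

theory Defs
  imports "HOL-Analysis.Analysis"
begin

definition bj_orth :: "'a::real_normed_vector \<Rightarrow> 'a \<Rightarrow> bool" where
  "bj_orth u v \<longleftrightarrow> (\<forall>t::real. norm (u + t *\<^sub>R v) \<ge> norm u)"

definition preserves_bj_at :: "('a::real_normed_vector \<Rightarrow> 'a) \<Rightarrow> 'a \<Rightarrow> bool" where
  "preserves_bj_at T x \<longleftrightarrow> (\<forall>w. bj_orth x w \<longrightarrow> bj_orth (T x) (T w))"

definition supp_functionals :: "'a::real_normed_vector \<Rightarrow> ('a \<Rightarrow>\<^sub>L real) set" where
  "supp_functionals z = {f. norm f = 1 \<and> blinfun_apply f z = norm z}"

definition k_smooth :: "nat \<Rightarrow> 'a::real_normed_vector \<Rightarrow> bool" where
  "k_smooth k z \<longleftrightarrow> z \<noteq> 0 \<and> dim (span (supp_functionals z)) = k"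

definition polyhedral_space :: "'a::real_normed_vector itself \<Rightarrow> bool" where
  "polyhedral_space _ \<longleftrightarrow> finite {x::'a. x extreme_point_of cball 0 1}"

definition K_set :: "'a::real_normed_vector set \<Rightarrow> bool" where
  "K_set A \<longleftrightarrow> A \<subseteq> sphere 0 1 \<and>
     (\<forall>T::'a \<Rightarrow> 'a. linear T \<and> (\<forall>x\<in>A. preserves_bj_at T x) \<longrightarrow>
        (\<exists>c\<ge>0. \<forall>x. norm (T x) = c * norm x))"

end

theory Submission
  imports Defs
begin

text \<open>Let \<open>E\<close> be the finite set of extreme points of the unit ball. The norm-one functionals that
  equal 1 on a spanning subset of \<open>E\<close> (\<open>facets\<close>) are finite in number, and those among them that
  norm \<open>x\<close> (\<open>active x\<close>) span the same space as \<open>J(x)\<close>; so \<open>x\<close> is \<open>k\<close>-smooth iff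
  \<open>dim (active x) = k\<close>.

  If \<open>T\<close> preserves orthogonality at \<open>x\<close> and \<open>f \<in> J(x)\<close>, then decomposing a multiple of \<open>y\<close> as \<open>x + w\<close>
  with \<open>f w = 0\<close> gives \<open>\<bar>f y\<bar> \<parallel>T x\<parallel> \<le> \<parallel>x\<parallel> \<parallel>T y\<parallel>\<close>. For active \<open>f\<close> this passes to limits of
  \<open>k\<close>-smooth points, hence to points whose smoothness is at least \<open>k\<close>, and from there to convex
  combinations inside a facet, hence to all points. Applied with \<open>x\<close> and \<open>y\<close> in the same facet,
  in both orders, it shows that \<open>\<parallel>T x\<parallel> / \<parallel>x\<parallel>\<close> is constant on each facet. This quotient is therefore a
  continuous function with finite range on the nonzero vectors, and it is even, so it is constant.\<close>

section \<open>Coordinates on a finite-dimensional normed space\<close>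

text \<open>A type definition cannot carry hypotheses, so the basis property is guarded by an
  implication. A finite nonempty set is then available for every real vector space, with
  \<open>{0}\<close> as the default when the guard fails.\<close>

lemma basis_index_set_exists:
  "\<exists>B::'a::real_vector set. finite B \<and> B \<noteq> {} \<and>
     ((\<exists>C::'a set. finite C \<and> span C = UNIV) \<and> (\<exists>x::'a. x \<noteq> 0) \<longrightarrow> independent B \<and> span B = UNIV)"
proof (cases "(\<exists>C::'a set. finite C \<and> span C = UNIV) \<and> (\<exists>x::'a. x \<noteq> 0)")
  case True
  then obtain C :: "'a set" and x :: 'a where C: "finite C" "span C = UNIV" and x: "x \<noteq> 0"
    by blast
  obtain B where B: "B \<subseteq> C" "independent B" "C \<subseteq> span B"
    using maximal_independent_subset by blast
  have "span B = UNIV"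
    using C(2) B(3) by (metis span_minimal subspace_span top.extremum_uniqueI)
  moreover from this x have "B \<noteq> {}"
    by auto
  ultimately show ?thesis
    using B(2) finite_subset[OF B(1) C(1)] by (intro exI[of _ B]) simp
next
  case False
  then show ?thesis
    by (intro exI[of _ "{0}"] conjI finite.intros insert_not_empty impI) (erule (1) notE)+
qed

definition basis_index_set :: "'a::real_vector set" where
  "basis_index_set = (SOME B. finite B \<and> B \<noteq> {} \<and>
     ((\<exists>C::'a set. finite C \<and> span C = UNIV) \<and> (\<exists>x::'a. x \<noteq> 0) \<longrightarrow> independent B \<and> span B = UNIV))"

lemma basis_index_set:
  shows "finite (basis_index_set :: 'a::real_vector set)" "basis_index_set \<noteq> ({} :: 'a set)"
    and "\<lbrakk>\<exists>C::'a set. finite C \<and> span C = UNIV; \<exists>x::'a. x \<noteq> 0\<rbrakk>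
      \<Longrightarrow> independent (basis_index_set :: 'a set) \<and> span (basis_index_set :: 'a set) = UNIV"
  using someI_ex[OF basis_index_set_exists[where ?'a='a]] unfolding basis_index_set_def[symmetric]
  by auto

text \<open>The polytope theory of the library lives on the class \<open>euclidean_space\<close>. Taking a basis of
  \<open>'a\<close> as index type makes \<open>real ^ 'a basis_index\<close> a Euclidean model of \<open>'a\<close>.\<close>

typedef (overloaded) ('a::real_vector) basis_index = "basis_index_set :: 'a set"
  using basis_index_set(2) by auto

instance basis_index :: (real_vector) finite
proof
  show "finite (UNIV :: 'a basis_index set)"
    using type_definition.univ[OF type_definition_basis_index] basis_index_set(1)
    by (metis finite_imageI)
qed

text \<open>Equivalence of norms: \<open>norm (L v)\<close> is continuous and nonzero on the compact
  Euclidean unit sphere, so it has a positive minimum there, and this minimum bounds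
  \<open>N\<close>.\<close>

lemma finite_dim_coordinates:
  assumes fd: "\<exists>C::'a::real_normed_vector set. finite C \<and> span C = UNIV" and nz: "\<exists>x::'a. x \<noteq> 0"
  obtains L :: "real ^ ('a::real_normed_vector) basis_index \<Rightarrow> 'a" and N :: "'a \<Rightarrow> real ^ 'a basis_index"
  where "bounded_linear L" "bounded_linear N" "\<forall>x. L (N x) = x" "\<forall>v. N (L v) = v"
proof -
  let ?B = "basis_index_set :: 'a set"
  have ind: "independent ?B" and sp: "span ?B = UNIV"
    using basis_index_set(3)[OF fd nz] by auto
  define L :: "real ^ 'a basis_index \<Rightarrow> 'a" where "L v = (\<Sum>i\<in>UNIV. v $ i *\<^sub>R Rep_basis_index i)" for v
  define N :: "'a \<Rightarrow> real ^ 'a basis_index" where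
    "N x = (\<chi> i. representation ?B x (Rep_basis_index i))" for x
  have bij: "bij_betw Rep_basis_index UNIV ?B"
    by (intro bij_betw_imageI injI)
      (simp_all add: Rep_basis_index_inject type_definition.Rep_range[OF type_definition_basis_index])
  have linL: "linear L"
    unfolding L_def by (intro linearI) (auto simp: scaleR_left_distrib sum.distrib scaleR_right.sum)
  have linN: "linear N"
    unfolding N_def
    by (intro linearI) (auto simp: vec_eq_iff representation_add[OF ind] representation_scale[OF ind] sp)
  have LN: "L (N x) = x" for x
  proof -
    have "L (N x) = (\<Sum>b\<in>?B. representation ?B x b *\<^sub>R b)"
      unfolding L_def N_def
      using sum.reindex_bij_betw[OF bij, of "\<lambda>b. representation ?B x b *\<^sub>R b"] by simp
    also have "\<dots> = x"
      using sum_representation_eq[OF ind, of x ?B] sp basis_index_set(1) by auto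
    finally show ?thesis .
  qed
  have NL: "N (L v) = v" for v
  proof -
    have "L (N (L v) - v) = 0"
      using LN linear_diff[OF linL] by simp
    moreover have "w = 0" if "L w = 0" for w
    proof -
      have "(\<Sum>b\<in>?B. (w $ Abs_basis_index b) *\<^sub>R b) = 0"
        using that sum.reindex_bij_betw[OF bij, of "\<lambda>b. (w $ Abs_basis_index b) *\<^sub>R b"]
        by (simp add: L_def Rep_basis_index_inverse)
      then have "w $ Abs_basis_index b = 0" if "b \<in> ?B" for b
        using ind that basis_index_set(1) independentD[of ?B ?B "\<lambda>b. w $ Abs_basis_index b" b] by simp
      then have "w $ i = 0" for i
        by (metis Rep_basis_index Rep_basis_index_inverse)
      then show ?thesis by (simp add: vec_eq_iff)
    qed
    ultimately show ?thesis by (metis right_minus_eq)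
  qed
  have bL: "bounded_linear L"
    using linL by (simp add: linear_conv_bounded_linear)
  have "continuous_on (sphere 0 1) (\<lambda>v. norm (L v))"
    using bL by (intro continuous_intros linear_continuous_on)
  moreover have "sphere (0 :: real ^ 'a basis_index) 1 \<noteq> {}"
    by simp
  ultimately obtain v0 where v0: "norm v0 = 1" "\<And>v. norm v = 1 \<Longrightarrow> norm (L v0) \<le> norm (L v)"
    using continuous_attains_inf[OF compact_sphere, of 0 1 "\<lambda>v. norm (L v)"] by auto
  have c: "norm (L v0) > 0"
    using v0(1) NL[of v0] linear_0[OF linN] by auto
  have low: "norm v * norm (L v0) \<le> norm (L v)" for v
  proof (cases "v = 0")
    case False
    then have "norm (L v0) \<le> norm (L (v /\<^sub>R norm v))"
      by (intro v0(2)) simp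
    also have "\<dots> = norm (L v) / norm v"
      by (simp add: linear_scale[OF linL] divide_inverse_commute)
    finally show ?thesis
      using False by (simp add: field_simps)
  qed simp
  have bN: "bounded_linear N"
  proof (intro bounded_linear_intro[where K = "1 / norm (L v0)"])
    show "norm (N x) \<le> norm x * (1 / norm (L v0))" for x
      using low[of "N x"] c by (simp add: LN field_simps)
  qed (use linN in \<open>auto simp: linear_add linear_scale\<close>)
  show thesis
    by (rule that[OF bL bN]) (use LN NL in auto)
qed

section \<open>Continuity, extreme points and norming functionals in finite dimension\<close>

lemma finite_dim_linear_bounded:
  fixes f :: "'a::real_normed_vector \<Rightarrow> 'b::real_normed_vector"
  assumes fd: "\<exists>C::'a set. finite C \<and> span C = UNIV" and nz: "\<exists>x::'a. x \<noteq> 0" and f: "linear f"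
  shows "bounded_linear f"
proof -
  obtain L :: "real ^ 'a basis_index \<Rightarrow> 'a" and N :: "'a \<Rightarrow> real ^ 'a basis_index"
    where L: "bounded_linear L" and N: "bounded_linear N" and LN: "\<forall>x. L (N x) = x"
      and "\<forall>v. N (L v) = v"
    by (rule finite_dim_coordinates[OF fd nz])
  have "bounded_linear (f \<circ> L)"
    using linear_compose[OF bounded_linear.linear[OF L] f] by (simp add: linear_conv_bounded_linear)
  from bounded_linear_compose[OF this N] show ?thesis
    by (simp add: LN)
qed

text \<open>Minkowski's theorem is applied to the compact convex image of the ball in coordinates;
  the linear isomorphism \<open>N\<close> matches extreme points with extreme points.\<close>

lemma finite_dim_cball_eq_hull:
  assumes fd: "\<exists>C::'a::real_normed_vector set. finite C \<and> span C = UNIV" and nz: "\<exists>x::'a. x \<noteq> 0"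
  shows "cball (0::'a) 1 = convex hull {x. x extreme_point_of cball 0 1}"
proof -
  obtain L :: "real ^ 'a basis_index \<Rightarrow> 'a" and N :: "'a \<Rightarrow> real ^ 'a basis_index"
    where L: "bounded_linear L" and N: "bounded_linear N" and "\<forall>x. L (N x) = x"
      and "\<forall>v. N (L v) = v"
    by (rule finite_dim_coordinates[OF fd nz])
  then have LN: "L (N x) = x" and NL: "N (L v) = v" for x v
    by auto
  interpret L: bounded_linear L by fact
  interpret N: bounded_linear N by fact
  let ?C = "N ` cball 0 1"
  have "?C = L -` cball 0 1"
  proof (intro set_eqI iffI)
    fix v assume "v \<in> L -` cball 0 1"
    then show "v \<in> ?C"
      by (intro image_eqI[of _ _ "L v"]) (auto simp: NL)
  qed (auto simp: LN)
  then have "closed ?C"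
    using continuous_closed_vimage[OF closed_cball linear_continuous_at[OF L]] by simp
  moreover have "bounded ?C"
    using bounded_linear_image[OF bounded_cball N] .
  ultimately have "compact ?C"
    using compact_eq_bounded_closed by blast
  moreover have "convex ?C"
    by (intro convex_linear_image N.linear convex_cball)
  ultimately have C: "?C = convex hull {v. v extreme_point_of ?C}"
    by (rule Krein_Milman_Minkowski)
  have injN: "inj N"
    using LN by (metis injI)
  have ext: "N x extreme_point_of ?C \<longleftrightarrow> x extreme_point_of cball 0 1" for x
    using face_of_linear_image[OF N.linear injN, of "{x}" "cball 0 1"] by (simp add: face_of_singleton)
  have "{v. v extreme_point_of ?C} = N ` {x. x extreme_point_of cball 0 1}"
  proof (intro set_eqI iffI)
    fix v assume "v \<in> {v. v extreme_point_of ?C}"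
    then show "v \<in> N ` {x. x extreme_point_of cball 0 1}"
      using ext[of "L v"] by (auto simp: NL image_iff intro!: exI[of _ "L v"])
  qed (use ext in auto)
  then have "?C = N ` (convex hull {x. x extreme_point_of cball 0 1})"
    using C convex_hull_linear_image[OF N.linear] by metis
  then show ?thesis
    using injN by (metis inj_image_eq_iff)
qed

text \<open>Hahn-Banach in coordinates: a hyperplane separates the open ball of radius
  \<open>norm x\<close> from \<open>x\<close>, and its normal \<open>a\<close>, rescaled to take the
  value \<open>norm x\<close> at \<open>x\<close>, gives a norming functional.\<close>

lemma finite_dim_supp_functionals_nonempty:
  fixes x :: "'a::real_normed_vector"
  assumes fd: "\<exists>C::'a set. finite C \<and> span C = UNIV" and x: "x \<noteq> 0"
  shows "supp_functionals x \<noteq> {}"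
proof -
  have nz: "\<exists>x::'a. x \<noteq> 0" using x by (rule exI)
  obtain L :: "real ^ 'a basis_index \<Rightarrow> 'a" and N :: "'a \<Rightarrow> real ^ 'a basis_index"
    where L: "bounded_linear L" and N: "bounded_linear N" and "\<forall>x. L (N x) = x"
      and "\<forall>v. N (L v) = v"
    by (rule finite_dim_coordinates[OF fd nz])
  then have LN: "L (N x) = x" and NL: "N (L v) = v" for x v
    by auto
  interpret L: bounded_linear L by fact
  interpret N: bounded_linear N by fact
  have cnv: "convex (N ` ball 0 (norm x))"
    by (intro convex_linear_image N.linear convex_ball)
  have "N y \<noteq> N x" if "norm y < norm x" for y
    using that by (metis LN less_irrefl)
  then have dis: "N ` ball 0 (norm x) \<inter> {N x} = {}"
    by force
  have ne: "N ` ball 0 (norm x) \<noteq> {}"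
    using x by simp
  obtain a b where a: "a \<noteq> 0" "\<forall>v\<in>N ` ball 0 (norm x). a \<bullet> v \<le> b" and "\<forall>v\<in>{N x}. a \<bullet> v \<ge> b"
    using separating_hyperplane_sets[OF cnv convex_singleton ne insert_not_empty dis] by blast
  then have ax: "a \<bullet> N x \<ge> b"
    by simp
  have le: "(a \<bullet> N y) * norm x \<le> (a \<bullet> N x) * norm y" for y
  proof (cases "y = 0")
    case True
    then show ?thesis by (simp add: N.zero)
  next
    case False
    \<comment> \<open>The multiple of \<open>y\<close> of norm \<open>r * norm x\<close> lies in the
      open ball when \<open>0 < r < 1\<close>; afterwards \<open>r\<close> tends to 1 from the
      left.\<close>
    have "a \<bullet> N y * (norm x * r) \<le> (a \<bullet> N x) * norm y" if r: "0 < r" "r < 1" for r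
    proof -
      have "a \<bullet> N ((r * norm x / norm y) *\<^sub>R y) \<le> a \<bullet> N x"
      proof (rule order_trans[OF bspec[OF a(2)] ax])
        show "N ((r * norm x / norm y) *\<^sub>R y) \<in> N ` ball 0 (norm x)"
          using r x False by (intro imageI) simp
      qed
      then show ?thesis
        using False by (simp add: N.scaleR field_simps)
    qed
    then have ev: "\<forall>\<^sub>F r in at_left 1. a \<bullet> N y * (norm x * r) \<le> (a \<bullet> N x) * norm y"
      by (auto simp: eventually_at_left_field intro!: exI[of _ 0])
    have lim: "((\<lambda>r. a \<bullet> N y * (norm x * r)) \<longlongrightarrow> a \<bullet> N y * (norm x * 1)) (at_left 1)"
      by (intro tendsto_intros)
    show ?thesis
      using tendsto_upperbound[OF lim ev] by simp
  qed
  \<comment> \<open>Testing \<open>le\<close> on \<open>L a\<close>, whose coordinate vector is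
    \<open>a\<close> itself, shows that the rescaling divides by a positive number.\<close>
  have pos: "a \<bullet> N x > 0"
  proof -
    have "a \<bullet> a * norm x \<le> (a \<bullet> N x) * norm (L a)"
      using le[of "L a"] by (simp add: NL)
    moreover have "a \<bullet> a * norm x > 0"
      using a(1) x by simp
    ultimately have "(a \<bullet> N x) * norm (L a) > 0"
      by linarith
    then show ?thesis
      by (simp add: zero_less_mult_iff)
  qed
  define f where "f = Blinfun (\<lambda>y. (a \<bullet> N y) * norm x / (a \<bullet> N x))"
  have "bounded_linear (\<lambda>y. (a \<bullet> N y) * norm x / (a \<bullet> N x))"
    using bounded_linear_mult_const[OF bounded_linear_inner_right_comp[OF N, of a],
        of "norm x / (a \<bullet> N x)"] by simp
  then have f: "blinfun_apply f y = (a \<bullet> N y) * norm x / (a \<bullet> N x)" for y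
    unfolding f_def by (simp add: bounded_linear_Blinfun_apply)
  have up: "blinfun_apply f y \<le> norm y" for y
    using le[of y] pos by (simp add: f field_simps)
  have fx: "blinfun_apply f x = norm x"
    using pos by (simp add: f)
  have "\<bar>blinfun_apply f y\<bar> \<le> norm y" for y
    using up[of y] up[of "-y"] by (simp add: blinfun.minus_right)
  then have "norm f \<le> 1"
    by (intro norm_blinfun_bound) auto
  moreover have "1 \<le> norm f"
    using norm_blinfun[of f x] fx x by simp
  ultimately show ?thesis
    using fx by (auto simp: supp_functionals_def)
qed

section \<open>Finite sets of functionals\<close>

text \<open>Ratio test: the constraint that becomes tight first is the one minimising
  \<open>a i / b i\<close> over the indices with \<open>b i > 0\<close>. Each later use moves a
  vector or a functional along a line until a new constraint becomes tight.\<close>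

lemma first_hitting_time:
  fixes a b :: "'i \<Rightarrow> real"
  assumes fin: "finite I" and i0: "i0 \<in> I" "b i0 > 0"
    and a0: "\<And>i. i \<in> I \<Longrightarrow> 0 \<le> a i" and ab: "\<And>i. \<lbrakk>i \<in> I; b i > 0\<rbrakk> \<Longrightarrow> a i > 0"
  shows "\<exists>t>0. (\<forall>i\<in>I. t * b i \<le> a i) \<and> (\<exists>j\<in>I. b j > 0 \<and> t * b j = a j)"
proof -
  define P where "P = {i \<in> I. b i > 0}"
  define t where "t = Min ((\<lambda>i. a i / b i) ` P)"
  have P: "finite P" "P \<noteq> {}"
    using fin i0 by (auto simp: P_def)
  then have "t \<in> (\<lambda>i. a i / b i) ` P"
    unfolding t_def by (intro Min_in) auto
  then obtain j where j: "j \<in> I" "b j > 0" "t = a j / b j"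
    by (auto simp: P_def)
  have t: "t > 0"
    using j ab by simp
  have "t * b i \<le> a i" if i: "i \<in> I" for i
  proof (cases "b i > 0")
    case True
    then have "t \<le> a i / b i"
      unfolding t_def using i P by (intro Min_le) (auto simp: P_def)
    then show ?thesis using True by (simp add: field_simps)
  next
    case False
    then have "t * b i \<le> 0"
      using t by (simp add: mult_le_0_iff)
    then show ?thesis using a0[OF i] by linarith
  qed
  then show ?thesis
    using t j by (intro exI[of _ t]) auto
qed

lemma notin_span_imp_separating_vector:
  fixes S :: "('a::real_normed_vector \<Rightarrow>\<^sub>L real) set"
  assumes "finite S" "g \<notin> span S"
  shows "\<exists>w. (\<forall>s\<in>S. blinfun_apply s w = 0) \<and> blinfun_apply g w \<noteq> 0"
  using assms
proof (induction S arbitrary: g rule: finite_induct)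
  case empty
  then have "g \<noteq> 0" by simp
  then show ?case
    by (metis blinfun_eqI empty_iff zero_blinfun.rep_eq)
next
  case (insert s S)
  have "g \<notin> span S"
    using insert.prems span_mono[of S "insert s S"] by blast
  then obtain w where w: "\<forall>s\<in>S. blinfun_apply s w = 0" "blinfun_apply g w \<noteq> 0"
    using insert.IH by blast
  show ?case
  proof (cases "blinfun_apply s w = 0")
    case True
    then show ?thesis using w by blast
  next
    case False
    \<comment> \<open>Elimination step: \<open>g'\<close> vanishes at \<open>w\<close>, so
      correcting \<open>w'\<close> along \<open>w\<close> until \<open>s\<close> vanishes leaves the
      value of \<open>g'\<close> unchanged, and there it agrees with \<open>g\<close>.\<close>
    define g' where "g' = g - (blinfun_apply g w / blinfun_apply s w) *\<^sub>R s"
    have "g' \<notin> span S"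
      using insert.prems by (auto simp: g'_def span_insert)
    then obtain w' where w': "\<forall>s\<in>S. blinfun_apply s w' = 0" "blinfun_apply g' w' \<noteq> 0"
      using insert.IH by blast
    define v where "v = w' - (blinfun_apply s w' / blinfun_apply s w) *\<^sub>R w"
    have "blinfun_apply s v = 0"
      using False by (simp add: v_def blinfun.diff_right blinfun.scaleR_right)
    moreover have "\<forall>s\<in>S. blinfun_apply s v = 0"
      using w w' by (simp add: v_def blinfun.diff_right blinfun.scaleR_right)
    moreover have "blinfun_apply g v = blinfun_apply g' w'"
      by (simp add: v_def g'_def blinfun.diff_right blinfun.scaleR_right blinfun.diff_left blinfun.scaleR_left)
    ultimately show ?thesis
      using w'(2) by (intro exI[of _ v]) auto
  qed
qed

text \<open>The functional is first built algebraically, 1 at \<open>x\<close> and 0 on a basis of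
  \<open>span S\<close>. The hypothesis \<open>bl\<close>, which holds in finite dimension, makes it
  continuous.\<close>

lemma notin_span_imp_separating_functional:
  fixes S :: "'a::real_normed_vector set"
  assumes "x \<notin> span S" and bl: "\<And>f::'a \<Rightarrow> real. linear f \<Longrightarrow> bounded_linear f"
  shows "\<exists>h :: 'a \<Rightarrow>\<^sub>L real. (\<forall>s\<in>S. blinfun_apply h s = 0) \<and> blinfun_apply h x \<noteq> 0"
proof -
  obtain B where B: "B \<subseteq> S" "independent B" "S \<subseteq> span B"
    using maximal_independent_subset by blast
  have xB: "x \<notin> span B"
    using assms(1) B(1) span_mono by blast
  then have "independent (insert x B)"
    using B(2) by (simp add: independent_insert)
  then obtain h :: "'a \<Rightarrow> real" where h: "linear h" "\<forall>b\<in>insert x B. h b = (if b = x then 1 else 0)"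
    using linear_independent_extend[of "insert x B" "\<lambda>b. if b = x then 1 else 0"] by blast
  have "h b = 0" if "b \<in> B" for b
    using h(2) that xB span_base by (metis insertCI)
  then have "h s = 0" if "s \<in> S" for s
    using linear_eq_0_on_span[OF h(1), of B] B(3) that by blast
  moreover have "blinfun_apply (Blinfun h) = h"
    using bl[OF h(1)] by (rule bounded_linear_Blinfun_apply)
  ultimately show ?thesis
    using h(2) by (intro exI[of _ "Blinfun h"]) simp
qed

section \<open>Dimension counts for finite families of functionals\<close>

lemma dim_insert_finite:
  fixes x :: "'a::real_vector"
  assumes "finite S" "x \<notin> span S"
  shows "dim (insert x S) = Suc (dim S)"
proof -
  obtain B where B: "B \<subseteq> S" "independent B" "S \<subseteq> span B" "card B = dim S"
    using basis_exists by blast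
  have xB: "x \<notin> span B"
    using assms(2) B(1) span_mono by blast
  show ?thesis
  proof (rule dim_unique)
    show "insert x B \<subseteq> insert x S" using B(1) by blast
    show "insert x S \<subseteq> span (insert x B)"
      using B(3) span_mono[of B "insert x B"] span_base[of x "insert x B"] by blast
    show "independent (insert x B)" using B(2) xB by (simp add: independent_insert)
    show "card (insert x B) = Suc (dim S)"
      using B(1,4) assms(1) xB span_base finite_subset by (metis card_insert_disjoint)
  qed
qed

text \<open>The common kernel of \<open>S\<close> has codimension at most \<open>card S\<close>: it
  fills the space together with \<open>span C\<close>. A functional adds a vector to
  \<open>C\<close> only if it is nonzero somewhere on the common kernel of the earlier ones.\<close>

lemma finite_functionals_complement:
  fixes S :: "('a::real_normed_vector \<Rightarrow>\<^sub>L real) set"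
  assumes "finite S"
  shows "\<exists>C. finite C \<and> card C \<le> card S \<and> (\<forall>x. \<exists>c\<in>span C. \<forall>s\<in>S. blinfun_apply s (x - c) = 0)"
  using assms
proof (induction S rule: finite_induct)
  case empty
  then show ?case by (intro exI[of _ "{}"]) simp
next
  case (insert s S)
  then obtain C where C: "finite C" "card C \<le> card S"
    "\<And>x. \<exists>c\<in>span C. \<forall>s\<in>S. blinfun_apply s (x - c) = 0"
    by blast
  show ?case
  proof (cases "\<exists>w. (\<forall>s\<in>S. blinfun_apply s w = 0) \<and> blinfun_apply s w \<noteq> 0")
    case False
    have "\<exists>c\<in>span C. \<forall>s\<in>insert s S. blinfun_apply s (x - c) = 0" for x
      using C(3)[of x] False by (metis insert_iff)
    then show ?thesis
      using C(1,2) insert.hyps by (intro exI[of _ C]) auto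
  next
    case True
    then obtain w where w: "\<And>r. r \<in> S \<Longrightarrow> blinfun_apply r w = 0" "blinfun_apply s w \<noteq> 0"
      by blast
    have "\<exists>c\<in>span (insert w C). \<forall>s\<in>insert s S. blinfun_apply s (x - c) = 0" for x
    proof -
      obtain c where c: "c \<in> span C" "\<And>r. r \<in> S \<Longrightarrow> blinfun_apply r (x - c) = 0"
        using C(3) by blast
      define d where "d = c + (blinfun_apply s (x - c) / blinfun_apply s w) *\<^sub>R w"
      have d: "blinfun_apply r (x - d) =
        blinfun_apply r (x - c) - blinfun_apply s (x - c) / blinfun_apply s w * blinfun_apply r w" for r
        by (simp add: d_def blinfun.diff_right blinfun.scaleR_right blinfun.add_right)
      have "c \<in> span (insert w C)" "w \<in> span (insert w C)"
        using c(1) span_mono[of C "insert w C"] span_base by blast+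
      then have "d \<in> span (insert w C)"
        unfolding d_def by (intro span_add span_scale)
      moreover have "\<forall>r\<in>insert s S. blinfun_apply r (x - d) = 0"
        using c(2) w by (auto simp: d)
      ultimately show ?thesis by blast
    qed
    then show ?thesis
      using C(1,2) insert.hyps
      by (intro exI[of _ "insert w C"]) (auto simp: card_insert_if)
  qed
qed

text \<open>Since the common kernel is trivial, the set \<open>C\<close> of the preceding lemma
  spans the whole space. Working with a basis of \<open>span S\<close> turns the bound by a
  cardinality into one by a dimension.\<close>

lemma dim_le_dim_total_functionals:
  fixes S :: "('a::real_normed_vector \<Rightarrow>\<^sub>L real) set"
  assumes "finite S" and tot: "\<And>w. (\<forall>s\<in>S. blinfun_apply s w = 0) \<Longrightarrow> w = 0"
  shows "dim (UNIV :: 'a set) \<le> dim S"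
proof -
  obtain B where B: "B \<subseteq> S" "independent B" "S \<subseteq> span B" "card B = dim S"
    using basis_exists by blast
  have finB: "finite B" using B(1) assms(1) finite_subset by blast
  have totB: "w = 0" if w: "\<forall>s\<in>B. blinfun_apply s w = 0" for w
  proof -
    have "subspace {s. blinfun_apply s w = 0}"
      by (auto simp: subspace_def blinfun.add_left blinfun.scaleR_left)
    then have "span B \<subseteq> {s. blinfun_apply s w = 0}"
      using w by (intro span_minimal) auto
    then show ?thesis using tot B(3) by blast
  qed
  obtain C where C: "finite C" "card C \<le> card B"
    "\<And>x. \<exists>c\<in>span C. \<forall>s\<in>B. blinfun_apply s (x - c) = 0"
    using finite_functionals_complement[OF finB] by blast
  have "x \<in> span C" for x
    using C(3)[of x] totB by (metis eq_iff_diff_eq_0)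
  then have "dim (UNIV :: 'a set) \<le> card C"
    using C(1) by (intro dim_le_card) auto
  then show ?thesis using C(2) B(4) by simp
qed

text \<open>A supporting direction of \<open>A\<close> at \<open>f\<close> whose zero set is as large as possible cuts out a facet
  of the convex hull of \<open>A\<close>.\<close>

lemma facet_direction_exists:
  fixes A :: "('a::real_normed_vector \<Rightarrow>\<^sub>L real) set"
  assumes fin: "finite A" and u0: "\<And>g. g \<in> A \<Longrightarrow> blinfun_apply g u0 \<le> 0"
    "blinfun_apply f u0 = 0" "\<exists>g\<in>A. blinfun_apply g u0 \<noteq> 0" and fA: "f \<in> A"
  obtains u where "\<forall>g\<in>A. blinfun_apply g u \<le> 0" "blinfun_apply f u = 0"
    "Suc (dim {g \<in> A. blinfun_apply g u = 0}) = dim A"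
proof -
  define P where "P u \<longleftrightarrow> (\<forall>g\<in>A. blinfun_apply g u \<le> 0) \<and> blinfun_apply f u = 0 \<and>
    (\<exists>g\<in>A. blinfun_apply g u \<noteq> 0)" for u
  define Z where "Z u = {g \<in> A. blinfun_apply g u = 0}" for u
  have "P u0" using u0 by (simp add: P_def)
  moreover have "\<forall>u. P u \<longrightarrow> card (Z u) < Suc (card A)"
    using fin by (auto simp: Z_def less_Suc_eq_le intro: card_mono)
  ultimately obtain u where u: "P u" "\<And>v. P v \<Longrightarrow> card (Z v) \<le> card (Z u)"
    using ex_has_greatest_nat[of P u0 "\<lambda>u. card (Z u)"] by blast
  obtain g0 where g0: "g0 \<in> A" "blinfun_apply g0 u \<noteq> 0"
    using u(1) by (auto simp: P_def)
  have finZ: "finite (Z u)" using fin by (simp add: Z_def)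
  have sub: "A \<subseteq> span (insert g0 (Z u))"
  proof
    fix g1 assume g1: "g1 \<in> A"
    show "g1 \<in> span (insert g0 (Z u))"
    proof (rule ccontr)
      assume "g1 \<notin> span (insert g0 (Z u))"
      then obtain w0 where w0: "\<forall>s\<in>insert g0 (Z u). blinfun_apply s w0 = 0" "blinfun_apply g1 w0 \<noteq> 0"
        using notin_span_imp_separating_vector finZ by (metis finite_insert)
      define w where "w = (if blinfun_apply g1 w0 > 0 then w0 else - w0)"
      have w: "\<And>s. s \<in> insert g0 (Z u) \<Longrightarrow> blinfun_apply s w = 0" "blinfun_apply g1 w > 0"
        using w0 by (auto simp: w_def blinfun.minus_right)
      have "\<exists>t>0. (\<forall>g\<in>A. t * blinfun_apply g w \<le> - blinfun_apply g u) \<and>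
        (\<exists>j\<in>A. blinfun_apply j w > 0 \<and> t * blinfun_apply j w = - blinfun_apply j u)"
      proof (rule first_hitting_time[where ?i0.0 = g1, OF fin g1])
        show "blinfun_apply g1 w > 0" by (fact w(2))
        show "0 \<le> - blinfun_apply g u" if "g \<in> A" for g
          using u(1) that by (simp add: P_def)
        show "0 < - blinfun_apply g u" if "g \<in> A" "0 < blinfun_apply g w" for g
          using u(1) that w(1)[of g] by (force simp: P_def Z_def less_le)
      qed
      then obtain t j where t: "t > 0" "\<forall>g\<in>A. t * blinfun_apply g w \<le> - blinfun_apply g u"
        and j: "j \<in> A" "blinfun_apply j w > 0" "t * blinfun_apply j w = - blinfun_apply j u"
        by blast
      \<comment> \<open>Tilting \<open>u\<close> along \<open>w\<close> keeps the old zeros and adds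
        the new zero \<open>j\<close>, against the maximality of \<open>u\<close>. As
        \<open>w\<close> vanishes at \<open>g0\<close>, the tilted direction is still nonzero at
        \<open>g0\<close>, so it remains admissible.\<close>
      define v where "v = u + t *\<^sub>R w"
      have v: "blinfun_apply g v = blinfun_apply g u + t * blinfun_apply g w" for g
        by (simp add: v_def blinfun.add_right blinfun.scaleR_right)
      have "f \<in> Z u" using u(1) fA by (simp add: P_def Z_def)
      then have "blinfun_apply f v = 0"
        using w(1)[of f] by (simp add: v Z_def)
      moreover have "blinfun_apply g v \<le> 0" if "g \<in> A" for g
        using t(2) that by (force simp: v)
      moreover have "blinfun_apply g0 v \<noteq> 0"
        using g0 w(1)[of g0] by (simp add: v)
      ultimately have "P v" using g0(1) by (auto simp: P_def)
      have "Z u \<subseteq> Z v" using w(1) by (auto simp: Z_def v)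
      moreover have "j \<in> Z v" using j by (simp add: Z_def v)
      moreover have "j \<notin> Z u" using j(2) w(1) by fastforce
      ultimately have "Z u \<subset> Z v" by blast
      then have "card (Z u) < card (Z v)"
        using fin by (intro psubset_card_mono) (auto simp: Z_def)
      then show False using u(2)[OF \<open>P v\<close>] by simp
    qed
  qed
  have "subspace {g. blinfun_apply g u = 0}"
    by (auto simp: subspace_def blinfun.add_left blinfun.scaleR_left)
  then have "span (Z u) \<subseteq> {g. blinfun_apply g u = 0}"
    by (intro span_minimal) (auto simp: Z_def)
  then have "g0 \<notin> span (Z u)" using g0(2) by blast
  then have "dim (insert g0 (Z u)) = Suc (dim (Z u))"
    by (intro dim_insert_finite finZ)
  moreover have "span (insert g0 (Z u)) = span A"
    using sub g0(1) unfolding span_eq by (auto simp: Z_def intro: span_base)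
  then have "dim (insert g0 (Z u)) = dim A"
    by (metis dim_span)
  ultimately show thesis
    using that[of u] u(1) by (simp add: P_def Z_def)
qed

section \<open>Facet functionals of a polyhedral ball\<close>

text \<open>In the application \<open>E\<close> is the set of extreme points of the ball. The last
  two assumptions carry what is used of finite dimension: continuity of linear functionals and
  existence of norming functionals.\<close>

locale polyhedral_ball =
  fixes E :: "'a::real_normed_vector set"
  assumes finE: "finite E" and hull: "cball 0 1 = convex hull E"
    and linear_bounded: "\<And>f::'a \<Rightarrow> real. linear f \<Longrightarrow> bounded_linear f"
    and supp_nonempty: "\<And>x::'a. x \<noteq> 0 \<Longrightarrow> supp_functionals x \<noteq> {}"
begin

text \<open>These functionals define the facets of the unit ball; equivalently they are the vertices
  of the dual ball. Spanning contact points determine the functional.\<close>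

definition facets :: "('a \<Rightarrow>\<^sub>L real) set" where
  "facets = {f. norm f = 1 \<and> span {e \<in> E. blinfun_apply f e = 1} = UNIV}"

definition active :: "'a \<Rightarrow> ('a \<Rightarrow>\<^sub>L real) set" where
  "active x = facets \<inter> supp_functionals x"

lemma norm_one_apply_le:
  fixes f :: "'a \<Rightarrow>\<^sub>L real"
  assumes "norm f = 1"
  shows "blinfun_apply f x \<le> norm x"
  using norm_blinfun[of f x] assms by simp

lemma norm_one_apply_E_le:
  fixes f :: "'a \<Rightarrow>\<^sub>L real"
  assumes "norm f = 1" "e \<in> E"
  shows "blinfun_apply f e \<le> 1"
proof -
  have "e \<in> cball 0 1"
    unfolding hull using assms(2) by (rule hull_inc)
  then show ?thesis
    using norm_one_apply_le[OF assms(1), of e] by simp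
qed

lemma apply_le_on_ball:
  fixes h :: "'a \<Rightarrow>\<^sub>L real"
  assumes "\<And>e. e \<in> E \<Longrightarrow> blinfun_apply h e \<le> c"
  shows "blinfun_apply h x \<le> c * norm x"
proof (cases "x = 0")
  case False
  have "convex {y. blinfun_apply h y \<le> c}"
    using convex_linear_vimage[OF bounded_linear.linear[OF blinfun.bounded_linear_right] convex_real_interval(2), of h c]
    by (simp add: vimage_def)
  then have "convex hull E \<subseteq> {y. blinfun_apply h y \<le> c}"
    using assms by (intro hull_minimal) auto
  moreover have "x /\<^sub>R norm x \<in> convex hull E"
    unfolding hull[symmetric] using False by simp
  ultimately have "blinfun_apply h (x /\<^sub>R norm x) \<le> c"
    by blast
  then show ?thesis
    using False by (simp add: blinfun.scaleR_right field_simps)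
qed simp

lemma norm_le_one:
  fixes h :: "'a \<Rightarrow>\<^sub>L real"
  assumes "\<And>e. e \<in> E \<Longrightarrow> blinfun_apply h e \<le> 1"
  shows "norm h \<le> 1"
proof (rule norm_blinfun_bound)
  show "norm (blinfun_apply h x) \<le> 1 * norm x" for x
    using apply_le_on_ball[of h 1 x] apply_le_on_ball[of h 1 "- x"] assms
    by (auto simp: blinfun.minus_right)
qed simp

section \<open>Support functionals and the facet functionals among them\<close>

lemma nonzero_functional_pos:
  fixes h :: "'a \<Rightarrow>\<^sub>L real"
  assumes "h \<noteq> 0"
  shows "\<exists>e\<in>E. blinfun_apply h e > 0"
proof (rule ccontr)
  assume "\<not> ?thesis"
  then have "blinfun_apply h e \<le> 0" if "e \<in> E" for e
    using that by (simp add: not_less)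
  then have "blinfun_apply h x \<le> 0" for x
    using apply_le_on_ball[of h 0 x] by simp
  from this this[of "- x" for x] have "blinfun_apply h x = 0" for x
    by (simp add: blinfun.minus_right order_antisym)
  then show False
    using assms by (simp add: blinfun_eqI)
qed

text \<open>The normalised \<open>x\<close> is a convex combination of \<open>E\<close>, and the
  equality \<open>f x = norm x\<close> forces all the weight onto points where \<open>f\<close> is
  1.\<close>

lemma vanish_on_contact_points:
  fixes f h :: "'a \<Rightarrow>\<^sub>L real"
  assumes f: "f \<in> supp_functionals x" and h: "\<And>e. \<lbrakk>e \<in> E; blinfun_apply f e = 1\<rbrakk> \<Longrightarrow> blinfun_apply h e = 0"
  shows "blinfun_apply h x = 0"
proof (cases "x = 0")
  case False
  have nf: "norm f = 1" and fx: "blinfun_apply f x = norm x"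
    using f by (auto simp: supp_functionals_def)
  have "x /\<^sub>R norm x \<in> convex hull E"
    unfolding hull[symmetric] using False by simp
  then obtain c where c: "\<And>e. e \<in> E \<Longrightarrow> 0 \<le> c e" "sum c E = 1" "(\<Sum>e\<in>E. c e *\<^sub>R e) = x /\<^sub>R norm x"
    unfolding convex_hull_finite[OF finE] by blast
  have ap: "(\<Sum>e\<in>E. c e * blinfun_apply g e) = blinfun_apply g x / norm x" for g
  proof -
    have "blinfun_apply g (x /\<^sub>R norm x) = (\<Sum>e\<in>E. c e * blinfun_apply g e)"
      unfolding c(3)[symmetric] by (simp add: blinfun.sum_right blinfun.scaleR_right)
    then show ?thesis by (simp add: blinfun.scaleR_right field_simps)
  qed
  have "(\<Sum>e\<in>E. c e * (1 - blinfun_apply f e)) = 0"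
    using ap[of f] c(2) fx False by (simp add: right_diff_distrib sum_subtractf)
  then have "\<forall>e\<in>E. c e * (1 - blinfun_apply f e) = 0"
    using c(1) norm_one_apply_E_le[OF nf] by (subst (asm) sum_nonneg_eq_0_iff[OF finE]) auto
  then have "\<forall>e\<in>E. c e * blinfun_apply h e = 0"
    using h by fastforce
  then have "blinfun_apply h x / norm x = 0"
    unfolding ap[symmetric] by (intro sum.neutral)
  then show ?thesis using False by simp
qed simp

text \<open>As \<open>h\<close> vanishes at the contact points of \<open>f\<close>, it vanishes at
  \<open>x\<close>. Hence \<open>f\<close> can be moved along \<open>h\<close> and stays norming at
  \<open>x\<close> until its value at a further point of \<open>E\<close> reaches 1.\<close>

lemma supp_functional_extend_contact:
  assumes f: "f \<in> supp_functionals x" and h: "h \<noteq> 0"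
    "\<And>e. \<lbrakk>e \<in> E; blinfun_apply f e = 1\<rbrakk> \<Longrightarrow> blinfun_apply h e = 0"
    and nz: "x \<noteq> 0"
  shows "\<exists>t>0. f + t *\<^sub>R h \<in> supp_functionals x \<and>
    {e \<in> E. blinfun_apply f e = 1} \<subset> {e \<in> E. blinfun_apply (f + t *\<^sub>R h) e = 1}"
proof -
  have nf: "norm f = 1" and fx: "blinfun_apply f x = norm x"
    using f by (auto simp: supp_functionals_def)
  obtain e0 where e0: "e0 \<in> E" "blinfun_apply h e0 > 0"
    using nonzero_functional_pos[OF h(1)] by blast
  have "\<exists>t>0. (\<forall>e\<in>E. t * blinfun_apply h e \<le> 1 - blinfun_apply f e) \<and>
    (\<exists>j\<in>E. blinfun_apply h j > 0 \<and> t * blinfun_apply h j = 1 - blinfun_apply f j)"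
  proof (rule first_hitting_time[where ?i0.0 = e0, OF finE e0(1)])
    show "0 < blinfun_apply h e0" by (fact e0(2))
    show "0 \<le> 1 - blinfun_apply f e" if "e \<in> E" for e
      using norm_one_apply_E_le[OF nf that] by simp
    show "0 < 1 - blinfun_apply f e" if "e \<in> E" "0 < blinfun_apply h e" for e
      using norm_one_apply_E_le[OF nf that(1)] h(2)[OF that(1)] that(2) by force
  qed
  then obtain t j where t: "t > 0" "\<And>e. e \<in> E \<Longrightarrow> t * blinfun_apply h e \<le> 1 - blinfun_apply f e"
    and j: "j \<in> E" "blinfun_apply h j > 0" "t * blinfun_apply h j = 1 - blinfun_apply f j"
    by blast
  let ?g = "f + t *\<^sub>R h"
  have g: "blinfun_apply ?g y = blinfun_apply f y + t * blinfun_apply h y" for y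
    by (simp add: blinfun.add_left blinfun.scaleR_left)
  have gx: "blinfun_apply ?g x = norm x"
    using vanish_on_contact_points[OF f h(2)] fx by (simp add: g)
  have "norm ?g \<le> 1"
    using t(2) by (intro norm_le_one) (force simp: g)
  moreover have "1 \<le> norm ?g"
    using norm_blinfun[of ?g x] gx nz by simp
  ultimately have "?g \<in> supp_functionals x"
    using gx by (simp add: supp_functionals_def)
  moreover have "{e \<in> E. blinfun_apply f e = 1} \<subseteq> {e \<in> E. blinfun_apply ?g e = 1}"
    using h(2) by (auto simp: g)
  moreover have "j \<in> {e \<in> E. blinfun_apply ?g e = 1}" "j \<notin> {e \<in> E. blinfun_apply f e = 1}"
    using j h(2)[of j] by (auto simp: g)
  ultimately show ?thesis using t(1) by blast
qed

text \<open>Induction on the number of non-contact points. If the contact points do not span, some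
  \<open>h \<noteq> 0\<close> vanishes on them, and \<open>f\<close> lies strictly between two
  support functionals, one in direction \<open>h\<close> and one in direction \<open>- h\<close>,
  each with more contact points. A weighted sum of these cancels \<open>h\<close>.\<close>

lemma supp_functionals_subset_span_active:
  assumes "f \<in> supp_functionals x" and nz: "x \<noteq> 0"
  shows "f \<in> span (active x)"
  using assms(1)
proof (induction "card E - card {e \<in> E. blinfun_apply f e = 1}" arbitrary: f rule: less_induct)
  case less
  let ?C = "\<lambda>f. {e \<in> E. blinfun_apply f e = 1}"
  show ?case
  proof (cases "span (?C f) = UNIV")
    case True
    then have "f \<in> active x"
      using less.prems by (simp add: active_def facets_def supp_functionals_def)
    then show ?thesis by (rule span_base)
  next
    case False
    then obtain z where z: "z \<notin> span (?C f)" by blast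
    have "\<exists>h. (\<forall>e\<in>?C f. blinfun_apply h e = 0) \<and> blinfun_apply h z \<noteq> (0::real)"
      by (rule notin_span_imp_separating_functional[OF z]) (rule linear_bounded)
    then obtain h :: "'a \<Rightarrow>\<^sub>L real"
      where h: "\<forall>e\<in>?C f. blinfun_apply h e = 0" "blinfun_apply h z \<noteq> 0"
      by blast
    have in_span: "\<exists>t>0. f + t *\<^sub>R g \<in> span (active x)"
      if g: "g \<noteq> 0" "\<forall>e\<in>?C f. blinfun_apply g e = 0" for g
    proof -
      obtain t where t: "t > 0" "f + t *\<^sub>R g \<in> supp_functionals x" "?C f \<subset> ?C (f + t *\<^sub>R g)"
        using supp_functional_extend_contact[OF less.prems g(1) _ nz] g(2) by auto
      have "card (?C f) < card (?C (f + t *\<^sub>R g))"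
        using t(3) finE by (intro psubset_card_mono) auto
      moreover have "card (?C (f + t *\<^sub>R g)) \<le> card E"
        using finE by (intro card_mono) auto
      ultimately have "card E - card (?C (f + t *\<^sub>R g)) < card E - card (?C f)"
        by linarith
      from less.hyps[OF this t(2)] show ?thesis using t(1) by blast
    qed
    have "h \<noteq> 0" using h(2) by auto
    then obtain t where t: "t > 0" "f + t *\<^sub>R h \<in> span (active x)"
      using in_span[of h] h(1) by blast
    have "- h \<noteq> 0" "\<forall>e\<in>?C f. blinfun_apply (- h) e = 0"
      using \<open>h \<noteq> 0\<close> h(1) by (auto simp: blinfun.minus_left)
    then obtain r where r: "r > 0" "f + r *\<^sub>R (- h) \<in> span (active x)"
      using in_span[of "- h"] by blast
    have "r *\<^sub>R (f + t *\<^sub>R h) + t *\<^sub>R (f + r *\<^sub>R (- h)) \<in> span (active x)"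
      by (rule span_add[OF span_scale[OF t(2)] span_scale[OF r(2)]])
    also have "r *\<^sub>R (f + t *\<^sub>R h) + t *\<^sub>R (f + r *\<^sub>R (- h)) = (r + t) *\<^sub>R f"
      by (simp add: algebra_simps)
    finally have "(1 / (r + t)) *\<^sub>R (r + t) *\<^sub>R f \<in> span (active x)"
      by (rule span_scale)
    then show ?thesis using t(1) r(1) by simp
  qed
qed

lemma span_supp_functionals:
  assumes "x \<noteq> 0"
  shows "span (supp_functionals x) = span (active x)"
  unfolding span_eq using supp_functionals_subset_span_active[OF _ assms]
  by (auto simp: active_def intro: span_base)

lemma k_smooth_iff_dim_active:
  assumes "x \<noteq> 0"
  shows "k_smooth k x \<longleftrightarrow> dim (active x) = k"
  using assms span_supp_functionals[OF assms] by (simp add: k_smooth_def del: dim_span) simp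

section \<open>Facet functionals determine the norm and are exposed\<close>

lemma in_active_iff: "g \<in> active x \<longleftrightarrow> g \<in> facets \<and> blinfun_apply g x = norm x"
  by (auto simp: active_def facets_def supp_functionals_def)

lemma active_nonempty:
  assumes "x \<noteq> 0"
  shows "active x \<noteq> {}"
proof
  assume "active x = {}"
  obtain f where f: "f \<in> supp_functionals x"
    using supp_nonempty[OF assms] by blast
  then have "f = 0"
    using supp_functionals_subset_span_active[OF f assms] \<open>active x = {}\<close> by simp
  then show False using f by (simp add: supp_functionals_def)
qed

lemma facets_apply_le: "g \<in> facets \<Longrightarrow> blinfun_apply g x \<le> norm x"
  by (simp add: facets_def norm_one_apply_le)

lemma norm_le_if_facets_le:
  assumes "\<And>g. g \<in> facets \<Longrightarrow> blinfun_apply g x \<le> c" "0 \<le> c"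
  shows "norm x \<le> c"
proof (cases "x = 0")
  case False
  then show ?thesis
    using active_nonempty[OF False] assms(1) by (force simp: in_active_iff)
qed (use assms(2) in simp)

lemma facets_eqI:
  assumes "f \<in> facets" "\<And>e. \<lbrakk>e \<in> E; blinfun_apply f e = 1\<rbrakk> \<Longrightarrow> blinfun_apply g e = 1"
  shows "g = f"
proof (rule blinfun_eqI)
  fix y
  have "y \<in> span {e \<in> E. blinfun_apply f e = 1}"
    using assms(1) by (simp add: facets_def)
  then show "blinfun_apply g y = blinfun_apply f y"
    by (rule linear_eq_on[OF bounded_linear.linear[OF blinfun.bounded_linear_right]
          bounded_linear.linear[OF blinfun.bounded_linear_right]]) (use assms(2) in auto)
qed

lemma finite_facets: "finite facets"
proof (rule inj_on_finite)
  show "inj_on (\<lambda>f. {e \<in> E. blinfun_apply f e = 1}) facets"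
    by (intro inj_onI) (rule facets_eqI, auto)
  show "(\<lambda>f. {e \<in> E. blinfun_apply f e = 1}) ` facets \<subseteq> Pow E"
    by auto
qed (use finE in simp)

lemma finite_active: "finite (active x)"
  by (simp add: active_def finite_facets)

text \<open>The witness is the sum of the contact points of \<open>f\<close>: every facet functional
  is at most 1 at each of them, and one different from \<open>f\<close> is below 1 at some.\<close>

lemma facet_exposed:
  assumes f: "f \<in> facets"
  obtains u where "\<And>g. \<lbrakk>g \<in> facets; g \<noteq> f\<rbrakk> \<Longrightarrow> blinfun_apply g u < blinfun_apply f u"
proof
  let ?C = "{e \<in> E. blinfun_apply f e = 1}"
  fix g assume g: "g \<in> facets" "g \<noteq> f"
  then obtain e where e: "e \<in> ?C" "blinfun_apply g e \<noteq> 1"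
    using facets_eqI[OF f, of g] by blast
  have le: "blinfun_apply g e \<le> 1" if "e \<in> E" for e
    using g(1) that by (simp add: facets_def norm_one_apply_E_le)
  have "(\<Sum>e\<in>?C. blinfun_apply g e) < (\<Sum>e\<in>?C. blinfun_apply f e)"
  proof (rule sum_strict_mono_ex1)
    show "\<exists>e\<in>?C. blinfun_apply g e < blinfun_apply f e"
      using e le[of e] by (intro bexI[of _ e]) auto
  qed (use finE le in auto)
  then show "blinfun_apply g (\<Sum>?C) < blinfun_apply f (\<Sum>?C)"
    by (simp add: blinfun.sum_right)
qed

end

section \<open>Operators preserving orthogonality\<close>

lemma preserves_bj_at_imp_le:
  fixes T :: "'a::real_normed_vector \<Rightarrow> 'a"
  assumes T: "linear T" and pres: "preserves_bj_at T x" and f: "f \<in> supp_functionals x" and x: "x \<noteq> 0"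
  shows "\<bar>blinfun_apply f y\<bar> * norm (T x) \<le> norm x * norm (T y)"
proof (cases "blinfun_apply f y = 0")
  case False
  have nf: "norm f = 1" and fx: "blinfun_apply f x = norm x"
    using f by (auto simp: supp_functionals_def)
  \<comment> \<open>Here \<open>x + w\<close> is the multiple of \<open>y\<close> at which
    \<open>f\<close> has the value \<open>norm x\<close>, so \<open>f w = 0\<close> and
    \<open>x\<close> is orthogonal to \<open>w\<close>.\<close>
  define w where "w = (norm x / blinfun_apply f y) *\<^sub>R y - x"
  have "norm x \<le> norm (x + t *\<^sub>R w)" for t
  proof -
    have "blinfun_apply f (x + t *\<^sub>R w) = norm x"
      using False fx by (simp add: w_def blinfun.add_right blinfun.diff_right blinfun.scaleR_right)
    then show ?thesis
      using norm_blinfun[of f "x + t *\<^sub>R w"] nf by simp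
  qed
  then have "bj_orth (T x) (T w)"
    using pres by (simp add: preserves_bj_at_def bj_orth_def)
  then have "norm (T x) \<le> norm (T x + 1 *\<^sub>R T w)"
    unfolding bj_orth_def by blast
  also have "T x + 1 *\<^sub>R T w = (norm x / blinfun_apply f y) *\<^sub>R T y"
    by (simp add: w_def linear_diff[OF T] linear_scale[OF T])
  finally show ?thesis
    using False by (simp add: field_simps)
qed simp

section \<open>Spreading the inequality from \<open>k\<close>-smooth points to all nonzero
  points\<close>

context polyhedral_ball
begin

context
  fixes T :: "'a \<Rightarrow> 'a" and k :: nat
  assumes T: "bounded_linear T" and k1: "1 \<le> k"
    and pres: "\<And>x. \<lbrakk>norm x = 1; k_smooth k x\<rbrakk> \<Longrightarrow> preserves_bj_at T x"
begin

interpretation T: bounded_linear T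
  by (fact T)

lemma le_at_k_smooth:
  assumes x: "x \<noteq> 0" "dim (active x) = k" and f: "f \<in> active x"
  shows "\<bar>blinfun_apply f y\<bar> * norm (T x) \<le> norm x * norm (T y)"
proof -
  let ?x = "x /\<^sub>R norm x"
  have act: "active ?x = active x"
    using x(1) by (auto simp: in_active_iff blinfun.scaleR_right field_simps)
  have x0: "?x \<noteq> 0" and n1: "norm ?x = 1" using x(1) by auto
  have "preserves_bj_at T ?x"
    using x act n1 k_smooth_iff_dim_active[OF x0] by (intro pres) auto
  moreover have "f \<in> supp_functionals ?x"
    using f act by (auto simp: active_def)
  ultimately have "\<bar>blinfun_apply f y\<bar> * norm (T ?x) \<le> norm ?x * norm (T y)"
    using preserves_bj_at_imp_le[OF T.linear _ _ x0] by blast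
  then show ?thesis
    using x(1) by (simp add: T.scaleR field_simps)
qed

text \<open>Induction on \<open>dim (active x)\<close>. Above \<open>k\<close>, the point
  \<open>x\<close> is the limit of points \<open>x + t *\<^sub>R u\<close> at which \<open>f\<close>
  stays active and the dimension drops by exactly one; both sides are continuous in the
  point.\<close>

lemma le_if_dim_active_ge:
  assumes "x \<noteq> 0" "k \<le> dim (active x)" "f \<in> active x"
  shows "\<bar>blinfun_apply f y\<bar> * norm (T x) \<le> norm x * norm (T y)"
  using assms
proof (induction "dim (active x)" arbitrary: x)
  case 0
  then show ?case using k1 by simp
next
  case (Suc d)
  note x = Suc.prems(1)
  have f: "f \<in> facets" "blinfun_apply f x = norm x"
    using Suc.prems(3) by (auto simp: in_active_iff)
  show ?case
  proof (cases "k = Suc d")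
    case True
    then show ?thesis using Suc.hyps(2) Suc.prems le_at_k_smooth by simp
  next
    case False
    then have kd: "k \<le> d" using Suc.hyps(2) Suc.prems(2) by simp
    obtain u0 where u0: "\<And>g. \<lbrakk>g \<in> facets; g \<noteq> f\<rbrakk> \<Longrightarrow> blinfun_apply g u0 < blinfun_apply f u0"
      using facet_exposed[OF f(1)] by blast
    \<comment> \<open>All active functionals agree at \<open>x\<close>, so subtracting this multiple
      of \<open>x\<close> makes \<open>f\<close> vanish while the other active functionals become
      negative: \<open>u1\<close> is a supporting direction at \<open>f\<close>.\<close>
    define u1 where "u1 = u0 - (blinfun_apply f u0 / norm x) *\<^sub>R x"
    have u1: "blinfun_apply g u1 = blinfun_apply g u0 - blinfun_apply f u0" if "g \<in> active x" for g
      using that x by (simp add: u1_def in_active_iff blinfun.diff_right blinfun.scaleR_right)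
    have "\<exists>g\<in>active x. g \<noteq> f"
    proof (rule ccontr)
      assume "\<not> ?thesis"
      then have "active x \<subseteq> {f}" by blast
      then have "dim (active x) \<le> 1"
        using card_mono[of "{f}" "active x"] dim_le_card'[OF finite_active, of x] by simp
      then show False using Suc.hyps(2) kd k1 by simp
    qed
    then have ex: "\<exists>g\<in>active x. blinfun_apply g u1 \<noteq> 0"
      using u0 u1 by (force simp: in_active_iff)
    have le: "blinfun_apply g u1 \<le> 0" if "g \<in> active x" for g
      using that u0[of g] u1[OF that] by (cases "g = f") (auto simp: in_active_iff)
    have "blinfun_apply f u1 = 0" using u1 Suc.prems(3) by simp
    then obtain u where u: "\<forall>g\<in>active x. blinfun_apply g u \<le> 0" "blinfun_apply f u = 0"
      "Suc (dim {g \<in> active x. blinfun_apply g u = 0}) = dim (active x)"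
      using facet_direction_exists[OF finite_active le _ ex Suc.prems(3)] by blast
    have ap: "blinfun_apply g (x + t *\<^sub>R u) = blinfun_apply g x + t * blinfun_apply g u" for g t
      by (simp add: blinfun.add_right blinfun.scaleR_right)
    \<comment> \<open>For small \<open>t\<close> the inactive functionals stay strictly below
      \<open>norm x\<close>, so the functionals active at \<open>x + t *\<^sub>R u\<close> are those
      active at \<open>x\<close> that vanish at \<open>u\<close>.\<close>
    have "\<forall>\<^sub>F t in at_right 0. \<forall>g\<in>facets - active x. blinfun_apply g x + t * blinfun_apply g u < norm x"
    proof (intro eventually_ball_finite ballI)
      fix g assume g: "g \<in> facets - active x"
      then have "blinfun_apply g x + 0 * blinfun_apply g u < norm x"
        using facets_apply_le[of g x] by (auto simp: in_active_iff less_le)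
      moreover have "((\<lambda>t. blinfun_apply g x + t * blinfun_apply g u) \<longlongrightarrow>
          blinfun_apply g x + 0 * blinfun_apply g u) (at_right 0)"
        by (intro tendsto_intros)
      ultimately show "\<forall>\<^sub>F t in at_right 0. blinfun_apply g x + t * blinfun_apply g u < norm x"
        by (rule order_tendstoD(2)[rotated])
    qed (use finite_facets in simp)
    moreover have "\<forall>\<^sub>F t in at_right (0::real). 0 < t"
      by (rule eventually_at_right_less)
    ultimately have ev: "\<forall>\<^sub>F t in at_right 0.
      \<bar>blinfun_apply f y\<bar> * norm (T (x + t *\<^sub>R u)) \<le> norm (x + t *\<^sub>R u) * norm (T y)"
    proof eventually_elim
      case (elim t)
      let ?z = "x + t *\<^sub>R u"
      have fz: "blinfun_apply f ?z = norm x" by (simp add: ap u(2) f)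
      have gz: "blinfun_apply g ?z \<le> norm x" if g: "g \<in> facets" for g
      proof (cases "g \<in> active x")
        case True
        then have "t * blinfun_apply g u \<le> 0"
          using u(1) elim(2) by (simp add: mult_le_0_iff)
        then show ?thesis using True by (simp add: ap in_active_iff)
      next
        case False
        then show ?thesis using elim(1) g by (force simp: ap)
      qed
      have nz: "norm ?z = norm x"
      proof (rule antisym)
        show "norm ?z \<le> norm x"
          using gz by (intro norm_le_if_facets_le) auto
        show "norm x \<le> norm ?z"
          using facets_apply_le[OF f(1), of ?z] fz by simp
      qed
      have act: "active ?z = {g \<in> active x. blinfun_apply g u = 0}"
      proof (intro set_eqI)
        fix g
        show "g \<in> active ?z \<longleftrightarrow> g \<in> {g \<in> active x. blinfun_apply g u = 0}"
        proof (cases "g \<in> active x")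
          case True
          then show ?thesis
            using elim(2) unfolding mem_Collect_eq in_active_iff nz by (auto simp: ap)
        next
          case False
          have "g \<notin> active ?z"
          proof
            assume "g \<in> active ?z"
            then have "g \<in> facets" "blinfun_apply g x + t * blinfun_apply g u = norm x"
              unfolding in_active_iff nz by (auto simp: ap)
            then show False using elim(1) False by force
          qed
          then show ?thesis using False by simp
        qed
      qed
      have dz: "dim (active ?z) = d" using u(3) Suc.hyps(2) by (simp add: act)
      show ?case
      proof (rule Suc.hyps(1))
        show "?z \<noteq> 0" using nz x by auto
        show "f \<in> active ?z" using Suc.prems(3) u(2) by (simp add: act)
      qed (use dz kd in auto)
    qed
    have "((\<lambda>t. x + t *\<^sub>R u) \<longlongrightarrow> x + 0 *\<^sub>R u) (at_right 0)"
      by (intro tendsto_intros)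
    then have lim: "((\<lambda>t. x + t *\<^sub>R u) \<longlongrightarrow> x) (at_right 0)" by simp
    show ?thesis
    proof (rule tendsto_le[OF _ _ _ ev])
      show "((\<lambda>t. \<bar>blinfun_apply f y\<bar> * norm (T (x + t *\<^sub>R u))) \<longlongrightarrow>
          \<bar>blinfun_apply f y\<bar> * norm (T x)) (at_right 0)"
        by (intro tendsto_mult tendsto_const tendsto_norm T.tendsto lim)
      show "((\<lambda>t. norm (x + t *\<^sub>R u) * norm (T y)) \<longlongrightarrow> norm x * norm (T y)) (at_right 0)"
        by (intro tendsto_mult tendsto_const tendsto_norm lim)
    qed simp
  qed
qed

text \<open>Along \<open>w\<close> the active functionals keep their value \<open>norm x\<close>,
  while some facet functional grows. The norm stays constant until the first inactive functional
  reaches \<open>norm x\<close> and becomes active.\<close>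

lemma active_extend:
  assumes x: "x \<noteq> 0" and w: "w \<noteq> 0" "\<And>g. g \<in> active x \<Longrightarrow> blinfun_apply g w = 0"
  shows "\<exists>t>0. norm (x + t *\<^sub>R w) = norm x \<and> active x \<subset> active (x + t *\<^sub>R w)"
proof -
  obtain g0 where g0: "g0 \<in> facets" "blinfun_apply g0 w > 0"
    using active_nonempty[OF w(1)] w(1) by (force simp: in_active_iff)
  have "\<exists>t>0. (\<forall>g\<in>facets. t * blinfun_apply g w \<le> norm x - blinfun_apply g x) \<and>
    (\<exists>j\<in>facets. blinfun_apply j w > 0 \<and> t * blinfun_apply j w = norm x - blinfun_apply j x)"
  proof (rule first_hitting_time[where ?i0.0 = g0, OF finite_facets g0(1)])
    show "0 < blinfun_apply g0 w" by (fact g0(2))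
    show "0 \<le> norm x - blinfun_apply g x" if "g \<in> facets" for g
      using facets_apply_le[OF that, of x] by simp
    show "0 < norm x - blinfun_apply g x" if "g \<in> facets" "0 < blinfun_apply g w" for g
      using facets_apply_le[OF that(1), of x] w(2)[of g] that by (force simp: in_active_iff)
  qed
  then obtain t j where t: "t > 0" "\<And>g. g \<in> facets \<Longrightarrow> t * blinfun_apply g w \<le> norm x - blinfun_apply g x"
    and j: "j \<in> facets" "blinfun_apply j w > 0" "t * blinfun_apply j w = norm x - blinfun_apply j x"
    by blast
  have ap: "blinfun_apply g (x + t *\<^sub>R w) = blinfun_apply g x + t * blinfun_apply g w" for g
    by (simp add: blinfun.add_right blinfun.scaleR_right)
  have nz: "norm (x + t *\<^sub>R w) = norm x"
  proof (rule antisym)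
    show "norm (x + t *\<^sub>R w) \<le> norm x"
    proof (rule norm_le_if_facets_le)
      show "blinfun_apply g (x + t *\<^sub>R w) \<le> norm x" if "g \<in> facets" for g
        using t(2)[OF that] by (simp add: ap)
    qed simp
    show "norm x \<le> norm (x + t *\<^sub>R w)"
      using facets_apply_le[OF j(1), of "x + t *\<^sub>R w"] j(3) by (simp add: ap)
  qed
  have "active x \<subseteq> active (x + t *\<^sub>R w)"
    using w(2) unfolding in_active_iff subset_iff nz by (simp add: ap)
  moreover have "j \<in> active (x + t *\<^sub>R w)"
    using j unfolding in_active_iff nz by (simp add: ap)
  moreover have "j \<notin> active x" using w(2)[of j] j(2) by auto
  ultimately show ?thesis using t(1) nz by blast
qed

text \<open>Induction on the number of inactive facet functionals. If the active ones have trivial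
  common kernel, their dimension is at least that of the space, hence at least \<open>k\<close>.
  Otherwise \<open>x\<close> lies strictly between two points of the same norm, in directions
  \<open>w\<close> and \<open>- w\<close>, with more active functionals, and convexity of the norm
  of \<open>T\<close> transfers the bound to \<open>x\<close>.\<close>

lemma le_at_active:
  assumes kd: "k \<le> dim (UNIV :: 'a set)" and "x \<noteq> 0" "f \<in> active x"
  shows "\<bar>blinfun_apply f y\<bar> * norm (T x) \<le> norm x * norm (T y)"
  using assms(2,3)
proof (induction "card facets - card (active x)" arbitrary: x rule: less_induct)
  case less
  show ?case
  proof (cases "\<exists>w. w \<noteq> 0 \<and> (\<forall>g\<in>active x. blinfun_apply g w = 0)")
    case False
    then have "dim (UNIV :: 'a set) \<le> dim (active x)"
      by (intro dim_le_dim_total_functionals finite_active) blast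
    then show ?thesis using le_if_dim_active_ge less.prems kd by simp
  next
    case True
    then obtain w where w: "w \<noteq> 0" "\<And>g. g \<in> active x \<Longrightarrow> blinfun_apply g w = 0" by blast
    have step: "\<exists>t>0. \<bar>blinfun_apply f y\<bar> * norm (T (x + t *\<^sub>R v)) \<le> norm x * norm (T y)"
      if v: "v \<noteq> 0" "\<And>g. g \<in> active x \<Longrightarrow> blinfun_apply g v = 0" for v
    proof -
      obtain t where t: "t > 0" "norm (x + t *\<^sub>R v) = norm x" "active x \<subset> active (x + t *\<^sub>R v)"
        using active_extend[OF less.prems(1) v] by blast
      have "card (active x) < card (active (x + t *\<^sub>R v))"
        using t(3) finite_active by (intro psubset_card_mono)
      moreover have "card (active (x + t *\<^sub>R v)) \<le> card facets"
        using finite_facets by (intro card_mono) (auto simp: active_def)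
      ultimately have "card facets - card (active (x + t *\<^sub>R v)) < card facets - card (active x)"
        by linarith
      moreover have "x + t *\<^sub>R v \<noteq> 0" using t(2) less.prems(1) by auto
      moreover have "f \<in> active (x + t *\<^sub>R v)" using t(3) less.prems(2) by blast
      ultimately have "\<bar>blinfun_apply f y\<bar> * norm (T (x + t *\<^sub>R v)) \<le> norm (x + t *\<^sub>R v) * norm (T y)"
        by (rule less.hyps)
      then show ?thesis using t(1,2) by auto
    qed
    obtain t where t: "t > 0" "\<bar>blinfun_apply f y\<bar> * norm (T (x + t *\<^sub>R w)) \<le> norm x * norm (T y)"
      using step[OF w] by blast
    have "- w \<noteq> 0" "\<And>g. g \<in> active x \<Longrightarrow> blinfun_apply g (- w) = 0"
      using w by (auto simp: blinfun.minus_right)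
    from step[OF this] obtain r where r: "r > 0"
      "\<bar>blinfun_apply f y\<bar> * norm (T (x + r *\<^sub>R (- w))) \<le> norm x * norm (T y)"
      by blast
    have "(r + t) *\<^sub>R T x = r *\<^sub>R T (x + t *\<^sub>R w) + t *\<^sub>R T (x + r *\<^sub>R (- w))"
      by (simp add: T.add T.scaleR T.diff algebra_simps)
    then have "(r + t) * norm (T x) \<le> r * norm (T (x + t *\<^sub>R w)) + t * norm (T (x + r *\<^sub>R (- w)))"
      using norm_triangle_ineq[of "r *\<^sub>R T (x + t *\<^sub>R w)" "t *\<^sub>R T (x + r *\<^sub>R (- w))"] t(1) r(1)
      by (metis abs_of_pos add_pos_pos norm_scaleR)
    then have "\<bar>blinfun_apply f y\<bar> * ((r + t) * norm (T x)) \<le>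
      \<bar>blinfun_apply f y\<bar> * (r * norm (T (x + t *\<^sub>R w)) + t * norm (T (x + r *\<^sub>R (- w))))"
      by (intro mult_left_mono) auto
    also have "\<dots> = r * (\<bar>blinfun_apply f y\<bar> * norm (T (x + t *\<^sub>R w))) +
        t * (\<bar>blinfun_apply f y\<bar> * norm (T (x + r *\<^sub>R (- w))))"
      by (simp only: distrib_left mult.left_commute)
    also have "\<dots> \<le> r * (norm x * norm (T y)) + t * (norm x * norm (T y))"
      using t r by (intro add_mono mult_left_mono) auto
    finally have "(r + t) * (\<bar>blinfun_apply f y\<bar> * norm (T x)) \<le> (r + t) * (norm x * norm (T y))"
      by (simp only: algebra_simps)
    then show ?thesis using t(1) r(1) by (simp add: mult_le_cancel_left)
  qed
qed

section \<open>Constancy of the ratio \<open>norm (T x) / norm x\<close>\<close>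

lemma scaled_isometry:
  assumes kd: "k \<le> dim (UNIV :: 'a set)"
  shows "\<exists>c\<ge>0. \<forall>x. norm (T x) = c * norm x"
proof -
  define r where "r x = norm (T x) / norm x" for x
  have r_le: "r x \<le> r y" if "x \<noteq> 0" "y \<noteq> 0" "f \<in> active x" "f \<in> active y" for x y f
  proof -
    have "norm y * norm (T x) \<le> norm x * norm (T y)"
      using le_at_active[OF kd that(1,3), of y] that(4) by (simp add: in_active_iff)
    then show ?thesis using that(1,2) by (simp add: r_def field_simps)
  qed
  have "finite (r ` (- {0}))"
  proof -
    \<comment> \<open>By \<open>r_le\<close> in both directions, \<open>r\<close> takes one value on
      all nonzero points sharing an active functional; a chosen representative for each facet
      functional therefore exhausts the range.\<close>
    have "r ` (- {0}) \<subseteq> (\<lambda>f. r (SOME x. x \<noteq> 0 \<and> f \<in> active x)) ` facets"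
    proof
      fix c assume "c \<in> r ` (- {0})"
      then obtain x where x: "x \<noteq> 0" "c = r x" by blast
      then obtain f where f: "f \<in> active x" using active_nonempty by blast
      let ?y = "SOME x. x \<noteq> 0 \<and> f \<in> active x"
      have "?y \<noteq> 0 \<and> f \<in> active ?y"
        using x f by (intro someI[of "\<lambda>x. x \<noteq> 0 \<and> f \<in> active x" x]) blast
      then have "r ?y = c"
        using r_le[of x ?y f] r_le[of ?y x f] x f by force
      then show "c \<in> (\<lambda>f. r (SOME x. x \<noteq> 0 \<and> f \<in> active x)) ` facets"
        using f by (auto simp: in_active_iff)
    qed
    then show ?thesis using finite_facets finite_surj by blast
  qed
  \<comment> \<open>On a segment avoiding the origin, \<open>r\<close> is continuous with finite
    range, hence constant by connectedness. If the segment meets the origin, \<open>y\<close> is a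
    nonzero multiple of \<open>x\<close> and homogeneity suffices.\<close>
  have r_eq: "r x = r y" if xy: "x \<noteq> 0" "y \<noteq> 0" for x y
  proof (cases "0 \<in> closed_segment x y")
    case False
    have "continuous_on (closed_segment x y) r"
      unfolding r_def using False T
      by (intro continuous_intros linear_continuous_on) auto
    moreover have "finite (r ` closed_segment x y)"
      using False by (intro finite_subset[OF _ \<open>finite (r ` (- {0}))\<close>] image_mono) auto
    ultimately have "r constant_on closed_segment x y"
      using continuous_finite_range_constant_eq[of "closed_segment x y"] connected_segment by blast
    then show ?thesis unfolding constant_on_def by force
  next
    case True
    then obtain u where u: "0 = (1 - u) *\<^sub>R x + u *\<^sub>R y" "0 \<le> u" "u \<le> 1"
      by (auto simp: in_segment)
    have "u \<noteq> 0" using u xy by auto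
    define s where "s = - ((1 - u) / u)"
    have y: "y = s *\<^sub>R x"
    proof -
      have "u *\<^sub>R y = u *\<^sub>R (s *\<^sub>R x)"
        using u(1) \<open>u \<noteq> 0\<close> by (simp add: s_def eq_neg_iff_add_eq_0 add.commute)
      then show ?thesis using \<open>u \<noteq> 0\<close> by (rule scaleR_left_imp_eq[rotated])
    qed
    then have "s \<noteq> 0" using xy by auto
    then show ?thesis unfolding y r_def by (simp add: T.scaleR)
  qed
  show ?thesis
  proof (cases "\<exists>z::'a. z \<noteq> 0")
    case True
    then obtain z :: 'a where z: "z \<noteq> 0" by blast
    have "norm (T x) = r z * norm x" for x
      using r_eq[OF z, of x] by (cases "x = 0") (auto simp: r_def T.zero)
    moreover have "0 \<le> r z" by (simp add: r_def)
    ultimately show ?thesis by blast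
  next
    case False
    then show ?thesis by (intro exI[of _ 0]) (metis T.zero mult_zero_left norm_zero order_refl)
  qed
qed

end

end

theorem mainTheorem19:
  fixes k :: nat
  assumes fin_dim: "\<exists>B::'a::banach set. finite B \<and> span B = UNIV"
    and poly: "polyhedral_space TYPE('a)"
    and k1: "1 \<le> k" and k2: "k \<le> dim (UNIV::'a set)"
  shows "K_set {z::'a. norm z = 1 \<and> k_smooth k z}"
proof -
  have nz: "\<exists>x::'a. x \<noteq> 0"
  proof (rule ccontr)
    assume "\<not> ?thesis"
    then have "(UNIV :: 'a set) \<subseteq> span {}" by auto
    then have "dim (UNIV :: 'a set) \<le> card ({} :: 'a set)"
      by (rule dim_le_card) simp
    then show False using k1 k2 by simp
  qed
  interpret polyhedral_ball "{x::'a. x extreme_point_of cball 0 1}"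
  proof (rule polyhedral_ball.intro)
    show "finite {x::'a. x extreme_point_of cball 0 1}"
      using poly by (simp add: polyhedral_space_def)
    show "cball 0 1 = convex hull {x::'a. x extreme_point_of cball 0 1}"
      by (rule finite_dim_cball_eq_hull[OF fin_dim nz])
    show "bounded_linear f" if "linear f" for f :: "'a \<Rightarrow> real"
      by (rule finite_dim_linear_bounded[OF fin_dim nz that])
    show "supp_functionals x \<noteq> {}" if "x \<noteq> 0" for x :: 'a
      by (rule finite_dim_supp_functionals_nonempty[OF fin_dim that])
  qed
  show ?thesis
    unfolding K_set_def
  proof (intro conjI allI impI)
    show "{z::'a. norm z = 1 \<and> k_smooth k z} \<subseteq> sphere 0 1" by auto
    fix T :: "'a \<Rightarrow> 'a"
    assume T: "linear T \<and> (\<forall>x\<in>{z. norm z = 1 \<and> k_smooth k z}. preserves_bj_at T x)"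
    show "\<exists>c\<ge>0. \<forall>x. norm (T x) = c * norm x"
    proof (rule scaled_isometry[OF _ k1 _ k2])
      show "bounded_linear T"
        using T by (intro finite_dim_linear_bounded[OF fin_dim nz]) blast
      show "preserves_bj_at T x" if "norm x = 1" "k_smooth k x" for x
        using T that by blast
    qed
  qed
qed

end
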